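(* Let $\mu>0$, $a\in\mathbb{R}$, let $d\ge 4$ be an integer and let $$\Delta_{MP1}(r)=r^2+a^2-\frac{\mu}{r^{d-4}}.$$ (1) If $d=4$ (with $r\in\mathbb{R}$), then $\Delta_{MP1}$ has real roots if and only if $a^2\le\mu$; in that case the roots are $r=\pm\sqrt{\mu-a^2}$, which are two distinct roots if $a^2\neq\mu$ and the single root $r=0$ if $a^2=\mu$. (2) If $d\ge5$ (with $r>0$), then for every $a\in\mathbb{R}$ the function $\Delta_{MP1}$ has exactly one root in $(0,\infty)$, namely the unique positive solution of $r^{2+k}+a^2r^k=\mu$ with $k=d-4$.
   Context: $\Delta_{MP1}$ is the horizon function of the $(d+1)$-dimensional Myers-Perry metric with rotation in a single plane, with mass parameter $\mu$ and rotation parameter $a$; its roots are the radii of the horizons. The coordinate $r$ ranges over $\mathbb{R}$ when $d=4$ and over $(0,\infty)$ when $d\geq5$. *)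

theory Defs
  imports Complex_Main
begin

(* The truncated subtraction d - 4 is the true one, as d >= 4 is assumed throughout.
   For d = 4 the denominator is r ^ 0 = 1, also at r = 0. *)
definition Delta_MP1 :: "real \<Rightarrow> real \<Rightarrow> nat \<Rightarrow> real \<Rightarrow> real" where
  "Delta_MP1 \<mu> a d r = r\<^sup>2 + a\<^sup>2 - \<mu> / r ^ (d - 4)"

definition radial_range :: "nat \<Rightarrow> real set" where
  "radial_range d = (if d = 4 then UNIV else {0<..})"

definition roots_MP1 :: "real \<Rightarrow> real \<Rightarrow> nat \<Rightarrow> real set" where
  "roots_MP1 \<mu> a d = {r \<in> radial_range d. Delta_MP1 \<mu> a d r = 0}"

end

(* Clearing the denominator turns the horizon equation into r ^ (2 + k) + a^2 r ^ k = \<mu>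
   with k = d - 4. For k = 0 this is a quadratic equation; in general the left-hand side is
   strictly increasing on the nonnegative reals, vanishes at 0 when k > 0, and
   exceeds \<mu> at r = \<mu> + 1. *)
theory Submission
  imports Defs
begin

lemma roots_MP1_4: "roots_MP1 \<mu> a 4 = {r. r\<^sup>2 = \<mu> - a\<^sup>2}"
  by (auto simp: roots_MP1_def radial_range_def Delta_MP1_def)

lemma Collect_power2_eq:
  fixes c :: real
  assumes "c \<ge> 0"
  shows "{r. r\<^sup>2 = c} = {sqrt c, - sqrt c}"
proof -
  have "r\<^sup>2 = c \<longleftrightarrow> r = sqrt c \<or> r = - sqrt c" for r
    using power2_eq_iff[of r "sqrt c"] assms by simp
  then show ?thesis by auto
qed

text \<open>Positivity of \<open>s\<close> is what permits multiplying by
  \<open>s ^ (d - 4)\<close>. At \<open>s = 0\<close> the equivalence could fail: division by zero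
  yields 0, so \<open>Delta_MP1\<close> takes the value \<open>a\<^sup>2\<close> there and would
  have a spurious root for \<open>a = 0\<close>.\<close>

lemma roots_MP1_gt_4:
  assumes "d > 4"
  shows "roots_MP1 \<mu> a d = {s. s > 0 \<and> s ^ (2 + (d - 4)) + a\<^sup>2 * s ^ (d - 4) = \<mu>}"
proof -
  have "Delta_MP1 \<mu> a d s = 0 \<longleftrightarrow> s ^ (2 + (d - 4)) + a\<^sup>2 * s ^ (d - 4) = \<mu>"
    if "s > 0" for s
  proof -
    have "Delta_MP1 \<mu> a d s = 0 \<longleftrightarrow> s\<^sup>2 + a\<^sup>2 = \<mu> / s ^ (d - 4)"
      by (simp add: Delta_MP1_def)
    also have "\<dots> \<longleftrightarrow> (s\<^sup>2 + a\<^sup>2) * s ^ (d - 4) = \<mu>"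
      using that by (simp add: eq_divide_eq)
    also have "(s\<^sup>2 + a\<^sup>2) * s ^ (d - 4) = s ^ (2 + (d - 4)) + a\<^sup>2 * s ^ (d - 4)"
      by (simp only: power_add distrib_right)
    finally show ?thesis .
  qed
  then show ?thesis
    using assms by (auto simp: roots_MP1_def radial_range_def)
qed

text \<open>Strictness comes from the first summand alone, whose exponent is always positive. The
  second is only weakly increasing, being constant when \<open>a = 0\<close> or
  \<open>k = 0\<close>. This yields uniqueness of the root.\<close>

lemma horizon_polynomial_strict_mono:
  fixes a s t :: real
  assumes "0 \<le> s" "s < t"
  shows "s ^ (2 + k) + a\<^sup>2 * s ^ k < t ^ (2 + k) + a\<^sup>2 * t ^ k"
proof (rule add_less_le_mono)
  show "s ^ (2 + k) < t ^ (2 + k)"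
    using assms by (intro power_strict_mono) auto
  show "a\<^sup>2 * s ^ k \<le> a\<^sup>2 * t ^ k"
    using assms by (intro mult_left_mono power_mono) auto
qed

lemma horizon_polynomial_root:
  fixes \<mu> a :: real
  assumes "\<mu> > 0" "k > 0"
  shows "\<exists>r>0. r ^ (2 + k) + a\<^sup>2 * r ^ k = \<mu>"
proof -
  let ?f = "\<lambda>r::real. r ^ (2 + k) + a\<^sup>2 * r ^ k"
  have zero: "?f 0 = 0"
    using assms by simp
  \<comment> \<open>The endpoint \<open>\<mu> + 1\<close> is chosen because its base is at least 1,
    so powers do not shrink it; \<open>\<mu>\<close> itself could be too small when
    \<open>\<mu> < 1\<close>.\<close>
  have "\<mu> \<le> (\<mu> + 1) ^ (2 + k)"
    using self_le_power[of "\<mu> + 1" "2 + k"] assms by linarith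
  also have "\<dots> \<le> ?f (\<mu> + 1)"
    using assms by simp
  finally have upper: "\<mu> \<le> ?f (\<mu> + 1)" .
  have "\<exists>r\<ge>0. r \<le> \<mu> + 1 \<and> ?f r = \<mu>"
  proof (rule IVT'[of ?f, OF _ upper])
    show "?f 0 \<le> \<mu>" "0 \<le> \<mu> + 1"
      using zero assms by linarith+
    show "continuous_on {0..\<mu> + 1} ?f"
      by (intro continuous_intros)
  qed
  then obtain r where r: "r \<ge> 0" "?f r = \<mu>" by blast
  \<comment> \<open>The intermediate value theorem on a closed interval only gives
    \<open>r \<ge> 0\<close>; the endpoint is excluded because \<open>?f\<close> is 0 there and
    \<open>\<mu> > 0\<close>.\<close>
  have "r \<noteq> 0"
    using r(2) zero assms(1) by (metis less_irrefl)
  with r show ?thesis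
    by (metis order_le_imp_less_or_eq)
qed

theorem mainTheorem5:
  fixes \<mu> a :: real and d :: nat
  assumes "\<mu> > 0" and "d \<ge> 4"
  shows "(d = 4 \<longrightarrow>
            (roots_MP1 \<mu> a d \<noteq> {} \<longleftrightarrow> a\<^sup>2 \<le> \<mu>) \<and>
            (a\<^sup>2 \<le> \<mu> \<longrightarrow>
               roots_MP1 \<mu> a d = {sqrt (\<mu> - a\<^sup>2), - sqrt (\<mu> - a\<^sup>2)} \<and>
               (a\<^sup>2 \<noteq> \<mu> \<longrightarrow> card (roots_MP1 \<mu> a d) = 2) \<and>
               (a\<^sup>2 = \<mu> \<longrightarrow> roots_MP1 \<mu> a d = {0}))) \<and>
         (d \<ge> 5 \<longrightarrow>
            (\<exists>r>0. roots_MP1 \<mu> a d = {r} \<and>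
               (let k = d - 4 in {s. s > 0 \<and> s ^ (2 + k) + a\<^sup>2 * s ^ k = \<mu>} = {r})))"
proof (intro conjI impI)
  assume "d = 4"
  then have roots: "roots_MP1 \<mu> a d = {r. r\<^sup>2 = \<mu> - a\<^sup>2}"
    by (simp add: roots_MP1_4)
  have sqrts: "roots_MP1 \<mu> a d = {sqrt (\<mu> - a\<^sup>2), - sqrt (\<mu> - a\<^sup>2)}" if "a\<^sup>2 \<le> \<mu>"
    using that Collect_power2_eq[of "\<mu> - a\<^sup>2"] roots by simp
  show "roots_MP1 \<mu> a d \<noteq> {} \<longleftrightarrow> a\<^sup>2 \<le> \<mu>"
  proof
    assume "roots_MP1 \<mu> a d \<noteq> {}"
    then obtain r where "r\<^sup>2 = \<mu> - a\<^sup>2"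
      using roots by blast
    then show "a\<^sup>2 \<le> \<mu>"
      using zero_le_power2[of r] by linarith
  qed (use sqrts in simp)
  assume le: "a\<^sup>2 \<le> \<mu>"
  then show "roots_MP1 \<mu> a d = {sqrt (\<mu> - a\<^sup>2), - sqrt (\<mu> - a\<^sup>2)}"
    by (rule sqrts)
  show "card (roots_MP1 \<mu> a d) = 2" if "a\<^sup>2 \<noteq> \<mu>"
  proof -
    \<comment> \<open>The two listed roots coincide only if the square root vanishes, which the
      strict inequality \<open>a\<^sup>2 < \<mu>\<close> rules out.\<close>
    have "sqrt (\<mu> - a\<^sup>2) > 0"
      using le that by simp
    then have "sqrt (\<mu> - a\<^sup>2) \<noteq> - sqrt (\<mu> - a\<^sup>2)"
      by linarith
    then show ?thesis
      unfolding sqrts[OF le] by (subst card_2_iff) blast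
  qed
  show "roots_MP1 \<mu> a d = {0}" if "a\<^sup>2 = \<mu>"
    using sqrts[OF le] that by simp
next
  assume d: "d \<ge> 5"
  obtain r where r: "r > 0" "r ^ (2 + (d - 4)) + a\<^sup>2 * r ^ (d - 4) = \<mu>"
    using horizon_polynomial_root[of \<mu> "d - 4" a] assms d by auto
  \<comment> \<open>By trichotomy: if \<open>s < r\<close> or \<open>r < s\<close>, strict
    monotonicity would give \<open>\<mu> < \<mu>\<close>.\<close>
  have "s = r" if s: "s > 0" "s ^ (2 + (d - 4)) + a\<^sup>2 * s ^ (d - 4) = \<mu>" for s
    using horizon_polynomial_strict_mono[of s r "d - 4" a]
      horizon_polynomial_strict_mono[of r s "d - 4" a] r s
    by (cases s r rule: linorder_cases) linarith+
  with r have unique: "{s. s > 0 \<and> s ^ (2 + (d - 4)) + a\<^sup>2 * s ^ (d - 4) = \<mu>} = {r}"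
    by blast
  moreover have "roots_MP1 \<mu> a d = {r}"
    using roots_MP1_gt_4[of d \<mu> a] unique d by simp
  ultimately show "\<exists>r>0. roots_MP1 \<mu> a d = {r} \<and>
      (let k = d - 4 in {s. s > 0 \<and> s ^ (2 + k) + a\<^sup>2 * s ^ k = \<mu>} = {r})"
    unfolding Let_def using r(1) by blast
qed

end
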